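(* For every positive integer $d$ and every $B>0$ there is a constant $C=C(d,B)$ such that the following holds. Let $p$ be a prime and let $\phi_1,\phi_2\in\mathbb{F}_p[y]$ be polynomials of degree at most $d$, vanishing at $0$ and linearly independent over $\mathbb{F}_p$. Assume the kernel estimate $$\|T_H\|_{\ell^2(\mathbb{F}_p)\to\ell^2(\mathbb{F}_p)}\le B\,p^{-1/2}\qquad\text{for every } H\in\mathbb{F}_p^2\setminus\{0\}.$$ Let $g_1,g_2:\mathbb{F}_p^2\to\mathbb{C}$ satisfy $$\mathbb{E}_{x_1\in\mathbb{F}_p}g_1(x_1,x_2)=0\ \text{ for every }x_2\in\mathbb{F}_p,\qquad \mathbb{E}_{x_2\in\mathbb{F}_p}g_2(x_1,x_2)=0\ \text{ for every }x_1\in\mathbb{F}_p.$$ Then $$\|J_3(g_1,g_2)\|_2^2\le C\Big(p^{-1}\|g_1\|_2^2\|g_2\|_2^2+p^{-1/4}\,\mathcal R(g_1)^{1/2}\,\mathcal C(g_2)^{1/2}\Big).$$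
   Context: $\mathbb{E}$ denotes the normalized average over the indicated finite set, and $\|g\|_2^2=\mathbb{E}_{x\in\mathbb{F}_p^2}|g(x)|^2$. Let $\psi(t)=e^{2\pi i t/p}$ for $t\in\mathbb{F}_p$. The bilinear operator is $$J_3(g_1,g_2)(x)=\mathbb{E}_{y\in\mathbb{F}_p}\,g_1(x_1+\phi_1(y),x_2)\,g_2(x_1,x_2+\phi_2(y)),\qquad x=(x_1,x_2)\in\mathbb{F}_p^2.$$ The fibre energies are $$\mathcal R(g)=\mathbb{E}_{x_2}\big(\mathbb{E}_{x_1}|g(x_1,x_2)|^2\big)^2,\qquad \mathcal C(g)=\mathbb{E}_{x_1}\big(\mathbb{E}_{x_2}|g(x_1,x_2)|^2\big)^2.$$ The operators $T_H$: for $a,b\in\mathbb{F}_p$ put $K(a,b)=\mathbb{E}_{y\in\mathbb{F}_p}\psi(a\phi_1(y)+b\phi_2(y))$ and $\widetilde K(a,b)=K(a,b)\mathbf 1_{b\ne0}$. For $H=(H_1,H_2)\in\mathbb{F}_p^2\setminus\{0\}$ put $$\Delta_H\widetilde K(n,m)=\widetilde K(n,m)\,\overline{\widetilde K(n-H_1,m+H_2)},\qquad C_H(m,m')=\sum_{n\in\mathbb{F}_p}\Delta_H\widetilde K(n,m)\,\overline{\Delta_H\widetilde K(n,m')},$$ and let $T_H$ be the operator on $\ell^2(\mathbb{F}_p)$ (counting measure) given by $(T_HF)(m)=\sum_{m'\in\mathbb{F}_p}C_H(m,m')F(m')$. *)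

theory Defs
  imports "HOL-Analysis.L2_Norm" "HOL-Analysis.Operator_Norm" "HOL-Number_Theory.Residues"
begin

text \<open>
  The prime \<open>p\<close> is quantified below the constant \<open>C\<close>, so \<open>F\<^sub>p\<close> cannot be a type. It is the
  library ring \<^term>\<open>residue_ring (int p)\<close>, with carrier \<open>{0..p-1}\<close>. Polynomials over it are the
  elements of the library's univariate polynomial ring \<^term>\<open>UP (residue_ring (int p))\<close>, whose
  elements are formal (coefficient sequences). Functions on \<open>F\<^sub>p\<close> and \<open>F\<^sub>p\<^sup>2\<close> are functions on
  \<^typ>\<open>int\<close> and \<^typ>\<open>int \<times> int\<close> of which only the values on the carrier are ever used.
\<close>

abbreviation Fp :: "nat \<Rightarrow> int ring" where
  "Fp p \<equiv> residue_ring (int p)"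

abbreviation FF :: "nat \<Rightarrow> int set" where
  "FF p \<equiv> carrier (Fp p)"

definition peval :: "nat \<Rightarrow> (nat \<Rightarrow> int) \<Rightarrow> int \<Rightarrow> int" where
  "peval p \<phi> y = eval (Fp p) (Fp p) id y \<phi>"

definition lin_indep_pair :: "nat \<Rightarrow> (nat \<Rightarrow> int) \<Rightarrow> (nat \<Rightarrow> int) \<Rightarrow> bool" where
  "lin_indep_pair p \<phi>1 \<phi>2 \<longleftrightarrow>
     (\<forall>a\<in>FF p. \<forall>b\<in>FF p.
        a \<odot>\<^bsub>UP (Fp p)\<^esub> \<phi>1 \<oplus>\<^bsub>UP (Fp p)\<^esub> b \<odot>\<^bsub>UP (Fp p)\<^esub> \<phi>2 = \<zero>\<^bsub>UP (Fp p)\<^esub>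
        \<longrightarrow> a = \<zero>\<^bsub>Fp p\<^esub> \<and> b = \<zero>\<^bsub>Fp p\<^esub>)"

definition avg :: "'a set \<Rightarrow> ('a \<Rightarrow> 'b::field) \<Rightarrow> 'b" where
  "avg A f = (\<Sum>x\<in>A. f x) / of_nat (card A)"

definition psi :: "nat \<Rightarrow> int \<Rightarrow> complex" where
  "psi p t = exp (2 * of_real pi * \<i> * of_int t / of_nat p)"

definition norm2_sq :: "nat \<Rightarrow> (int \<times> int \<Rightarrow> complex) \<Rightarrow> real" where
  "norm2_sq p g = avg (FF p \<times> FF p) (\<lambda>x. (cmod (g x))\<^sup>2)"

definition J3 :: "nat \<Rightarrow> (nat \<Rightarrow> int) \<Rightarrow> (nat \<Rightarrow> int) \<Rightarrow>
    (int \<times> int \<Rightarrow> complex) \<Rightarrow> (int \<times> int \<Rightarrow> complex) \<Rightarrow> int \<times> int \<Rightarrow> complex" where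
  "J3 p \<phi>1 \<phi>2 g1 g2 = (\<lambda>(x1, x2). avg (FF p) (\<lambda>y.
     g1 (x1 \<oplus>\<^bsub>Fp p\<^esub> peval p \<phi>1 y, x2) * g2 (x1, x2 \<oplus>\<^bsub>Fp p\<^esub> peval p \<phi>2 y)))"

definition row_energy :: "nat \<Rightarrow> (int \<times> int \<Rightarrow> complex) \<Rightarrow> real" where
  "row_energy p g = avg (FF p) (\<lambda>x2. (avg (FF p) (\<lambda>x1. (cmod (g (x1, x2)))\<^sup>2))\<^sup>2)"

definition col_energy :: "nat \<Rightarrow> (int \<times> int \<Rightarrow> complex) \<Rightarrow> real" where
  "col_energy p g = avg (FF p) (\<lambda>x1. (avg (FF p) (\<lambda>x2. (cmod (g (x1, x2)))\<^sup>2))\<^sup>2)"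

definition kerK :: "nat \<Rightarrow> (nat \<Rightarrow> int) \<Rightarrow> (nat \<Rightarrow> int) \<Rightarrow> int \<Rightarrow> int \<Rightarrow> complex" where
  "kerK p \<phi>1 \<phi>2 a b = avg (FF p) (\<lambda>y.
     psi p (a \<otimes>\<^bsub>Fp p\<^esub> peval p \<phi>1 y \<oplus>\<^bsub>Fp p\<^esub> b \<otimes>\<^bsub>Fp p\<^esub> peval p \<phi>2 y))"

definition kerKt :: "nat \<Rightarrow> (nat \<Rightarrow> int) \<Rightarrow> (nat \<Rightarrow> int) \<Rightarrow> int \<Rightarrow> int \<Rightarrow> complex" where
  "kerKt p \<phi>1 \<phi>2 a b = (if b \<noteq> \<zero>\<^bsub>Fp p\<^esub> then kerK p \<phi>1 \<phi>2 a b else 0)"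

definition DeltaK :: "nat \<Rightarrow> (nat \<Rightarrow> int) \<Rightarrow> (nat \<Rightarrow> int) \<Rightarrow> int \<times> int \<Rightarrow> int \<Rightarrow> int \<Rightarrow> complex" where
  "DeltaK p \<phi>1 \<phi>2 H n m =
     kerKt p \<phi>1 \<phi>2 n m * cnj (kerKt p \<phi>1 \<phi>2 (n \<ominus>\<^bsub>Fp p\<^esub> fst H) (m \<oplus>\<^bsub>Fp p\<^esub> snd H))"

definition CH :: "nat \<Rightarrow> (nat \<Rightarrow> int) \<Rightarrow> (nat \<Rightarrow> int) \<Rightarrow> int \<times> int \<Rightarrow> int \<Rightarrow> int \<Rightarrow> complex" where
  "CH p \<phi>1 \<phi>2 H m m' =
     (\<Sum>n\<in>FF p. DeltaK p \<phi>1 \<phi>2 H n m * cnj (DeltaK p \<phi>1 \<phi>2 H n m'))"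

definition TH :: "nat \<Rightarrow> (nat \<Rightarrow> int) \<Rightarrow> (nat \<Rightarrow> int) \<Rightarrow> int \<times> int \<Rightarrow>
    (int \<Rightarrow> complex) \<Rightarrow> int \<Rightarrow> complex" where
  "TH p \<phi>1 \<phi>2 H F m = (\<Sum>m'\<in>FF p. CH p \<phi>1 \<phi>2 H m m' * F m')"

text \<open>
  The operator norm on \<open>\<ell>\<^sup>2(A)\<close> with counting measure, written as in the library's \<^const>\<open>onorm\<close>
  (quotients with \<open>F = 0\<close> on \<open>A\<close> are \<open>0\<close>). For finite \<open>A\<close> and \<open>T\<close> given by a kernel on
  \<open>A\<close>, the supremum is over a bounded set, by \<open>bdd_above_l2_quotients\<close> below.
\<close>

definition l2_opnorm :: "'a set \<Rightarrow> (('a \<Rightarrow> complex) \<Rightarrow> 'a \<Rightarrow> complex) \<Rightarrow> real" where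
  "l2_opnorm A T =
     (SUP F. L2_set (\<lambda>m. cmod (T F m)) A / L2_set (\<lambda>m. cmod (F m)) A)"

lemma bdd_above_l2_quotients:
  fixes k :: "'a \<Rightarrow> 'a \<Rightarrow> complex"
  assumes "finite A"
  shows "bdd_above (range (\<lambda>F.
           L2_set (\<lambda>m. cmod (\<Sum>m'\<in>A. k m m' * F m')) A / L2_set (\<lambda>m. cmod (F m)) A))"
proof (rule bdd_aboveI2)
  fix F :: "'a \<Rightarrow> complex"
  let ?N = "L2_set (\<lambda>m. cmod (F m)) A"
  let ?S = "\<Sum>m\<in>A. \<Sum>m'\<in>A. cmod (k m m')"
  have "L2_set (\<lambda>m. cmod (\<Sum>m'\<in>A. k m m' * F m')) A \<le> (\<Sum>m\<in>A. cmod (\<Sum>m'\<in>A. k m m' * F m'))"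
    by (rule L2_set_le_sum) simp
  also have "\<dots> \<le> (\<Sum>m\<in>A. \<Sum>m'\<in>A. cmod (k m m') * ?N)"
  proof (intro sum_mono order_trans[OF norm_sum])
    fix m m' assume "m' \<in> A"
    then have "cmod (F m') \<le> ?N"
      using assms by (intro member_le_L2_set)
    then show "cmod (k m m' * F m') \<le> cmod (k m m') * ?N"
      by (simp add: norm_mult mult_left_mono)
  qed
  finally have "L2_set (\<lambda>m. cmod (\<Sum>m'\<in>A. k m m' * F m')) A \<le> ?S * ?N"
    by (simp add: sum_distrib_right)
  moreover have "?N \<ge> 0" "?S \<ge> 0"
    by (simp_all add: sum_nonneg)
  ultimately show "L2_set (\<lambda>m. cmod (\<Sum>m'\<in>A. k m m' * F m')) A / ?N \<le> ?S"
    by (cases "?N = 0") (auto simp: divide_le_eq less_le)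
qed

end

theory Submission
  imports Defs "HOL-Analysis.Complex_Transcendental"
begin

text \<open>
  Expand \<open>g\<^sub>1\<close> in a Fourier series in its first variable and \<open>g\<^sub>2\<close> in its second one, with
  coefficients \<open>a\<^sub>n(x\<^sub>2)\<close> and \<open>b\<^sub>m(x\<^sub>1)\<close>. The average over \<open>y\<close> in \<open>J\<^sub>3\<close> then becomes the kernel:
  \<open>J\<^sub>3(g\<^sub>1,g\<^sub>2)(x) = \<Sum>\<^bsub>n,m\<^esub> K(n,m) a\<^sub>n(x\<^sub>2) b\<^sub>m(x\<^sub>1) \<psi>(n x\<^sub>1 + m x\<^sub>2)\<close>. The mean zero condition on
  \<open>g\<^sub>2\<close> removes \<open>m = 0\<close>, so from here on \<open>K\<close> stands for the truncated kernel (\<open>J3_expansion\<close>).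

  Square, average over \<open>x\<close>, and write the second pair of frequencies as \<open>(n - H\<^sub>1, m + H\<^sub>2)\<close>. The
  variables \<open>x\<^sub>1\<close> and \<open>x\<^sub>2\<close> separate, and the result is
  \<open>\<Sum>\<^sub>H \<Sum>\<^bsub>n,m\<^esub> \<Delta>\<^sub>HK(n,m) A\<^sub>H(n) B\<^sub>H(m)\<close> with correlations \<open>A\<^sub>H\<close> of the \<open>a\<^sub>n\<close> and \<open>B\<^sub>H\<close> of the \<open>b\<^sub>m\<close>
  (\<open>avg_norm_sq_expansion\<close>). The inner sum is a bilinear form with matrix \<open>M = \<Delta>\<^sub>HK\<close>, and
  \<open>T\<^sub>H\<close> is the Gram operator of \<open>M\<close>, so for \<open>H \<noteq> 0\<close> it is at most
  \<open>\<parallel>T\<^sub>H\<parallel>\<^bsup>1/2\<^esup> \<parallel>A\<^sub>H\<parallel> \<parallel>B\<^sub>H\<parallel>\<close> (\<open>bilinear_form_bound\<close>). By Parseval \<open>\<Sum>\<^sub>H \<parallel>A\<^sub>H\<parallel>\<^sup>2\<close> is exactly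
  the row energy of \<open>g\<^sub>1\<close> and \<open>\<Sum>\<^sub>H \<parallel>B\<^sub>H\<parallel>\<^sup>2\<close> the column energy of \<open>g\<^sub>2\<close>
  (\<open>sum_correlation_energy\<close>, \<open>sum_correlation_energy_shift\<close>). Cauchy-Schwarz in \<open>H\<close> gives the
  term with \<open>p\<^bsup>-1/4\<^esup>\<close>.

  The term \<open>H = 0\<close> is at most \<open>max |K|\<^sup>2 \<parallel>g\<^sub>1\<parallel>\<^sup>2 \<parallel>g\<^sub>2\<parallel>\<^sup>2\<close>, and the hypothesis on \<open>T\<^sub>H\<close> controls this
  maximum as well: since \<open>K(-n,-m)\<close> is the conjugate of \<open>K(n,m)\<close>, the number \<open>K(n,m)\<^sup>2\<close> is an
  entry of \<open>\<Delta>\<^sub>HK\<close> for \<open>H = (2n,-2m)\<close>, which for odd \<open>p\<close> and \<open>m \<noteq> 0\<close> is nonzero. Hence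
  \<open>|K|\<^sup>2 \<le> B\<^bsup>1/2\<^esup> p\<^bsup>-1/4\<^esup>\<close> (\<open>kernel_sup_bound\<close>). As \<open>\<parallel>g\<^sub>1\<parallel>\<^sup>2 \<le> \<R>(g\<^sub>1)\<^bsup>1/2\<^esup>\<close> and
  \<open>\<parallel>g\<^sub>2\<parallel>\<^sup>2 \<le> \<C>(g\<^sub>2)\<^bsup>1/2\<^esup>\<close>, the diagonal is absorbed by the same term. For \<open>p = 2\<close> the trivial bound
  \<open>|K| \<le> 1\<close> puts it into the term with \<open>p\<^bsup>-1\<^esup>\<close>.
\<close>

section \<open>Averages and sums\<close>

lemma avg_nonneg: "(\<And>x. x \<in> A \<Longrightarrow> 0 \<le> f x) \<Longrightarrow> 0 \<le> avg A f"
  for f :: "'a \<Rightarrow> real"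
  by (simp add: avg_def sum_nonneg)

lemma avg_le_sqrt_avg_sq:
  fixes f :: "'a \<Rightarrow> real"
  shows "avg A f \<le> sqrt (avg A (\<lambda>x. (f x)\<^sup>2))"
proof -
  let ?c = "real (card A)"
  have "sum f A \<le> (\<Sum>x\<in>A. \<bar>f x\<bar> * \<bar>1\<bar>)"
    by (simp add: sum_mono)
  also have "\<dots> \<le> L2_set f A * L2_set (\<lambda>_. 1) A"
    by (rule L2_set_mult_ineq)
  also have "\<dots> = sqrt (\<Sum>x\<in>A. (f x)\<^sup>2) * sqrt ?c"
    by (simp add: L2_set_def)
  finally have "avg A f \<le> sqrt (\<Sum>x\<in>A. (f x)\<^sup>2) * sqrt ?c / ?c"
    by (simp add: avg_def divide_right_mono)
  also have "\<dots> = sqrt (avg A (\<lambda>x. (f x)\<^sup>2))"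
    unfolding avg_def real_sqrt_divide times_divide_eq_right[symmetric]
      sqrt_divide_self_eq[OF of_nat_0_le_iff] by (simp only: divide_inverse)
  finally show ?thesis .
qed

lemma sum_avg: "(\<Sum>n\<in>S. avg A (f n)) = avg A (\<lambda>x. \<Sum>n\<in>S. f n x)"
proof -
  have "(\<Sum>n\<in>S. \<Sum>x\<in>A. f n x) = (\<Sum>x\<in>A. \<Sum>n\<in>S. f n x)"
    by (rule sum.swap)
  then show ?thesis
    by (simp add: avg_def flip: sum_divide_distrib)
qed

lemma sum_swap_pairs:
  "(\<Sum>a\<in>A. \<Sum>b\<in>B. \<Sum>c\<in>C. \<Sum>d\<in>D. f a b c d) = (\<Sum>c\<in>C. \<Sum>d\<in>D. \<Sum>a\<in>A. \<Sum>b\<in>B. f a b c d)"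
proof -
  have "(\<Sum>a\<in>A. \<Sum>b\<in>B. \<Sum>c\<in>C. \<Sum>d\<in>D. f a b c d) = (\<Sum>a\<in>A. \<Sum>c\<in>C. \<Sum>b\<in>B. \<Sum>d\<in>D. f a b c d)"
    by (rule sum.cong[OF refl], rule sum.swap)
  also have "\<dots> = (\<Sum>c\<in>C. \<Sum>a\<in>A. \<Sum>b\<in>B. \<Sum>d\<in>D. f a b c d)"
    by (rule sum.swap)
  also have "\<dots> = (\<Sum>c\<in>C. \<Sum>a\<in>A. \<Sum>d\<in>D. \<Sum>b\<in>B. f a b c d)"
    by (rule sum.cong[OF refl], rule sum.cong[OF refl], rule sum.swap)
  also have "\<dots> = (\<Sum>c\<in>C. \<Sum>d\<in>D. \<Sum>a\<in>A. \<Sum>b\<in>B. f a b c d)"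
    by (rule sum.cong[OF refl], rule sum.swap)
  finally show ?thesis .
qed

section \<open>Bilinear forms and operator norms\<close>

lemma l2_opnorm_bound:
  fixes k :: "'a \<Rightarrow> 'a \<Rightarrow> complex"
  assumes A: "finite A" and T: "T = (\<lambda>F m. \<Sum>m'\<in>A. k m m' * F m')"
  shows "L2_set (\<lambda>m. cmod (T F m)) A \<le> l2_opnorm A T * L2_set (\<lambda>m. cmod (F m)) A"
proof (cases "L2_set (\<lambda>m. cmod (F m)) A = 0")
  case True
  then have "\<forall>m\<in>A. F m = 0"
    using A by (simp add: L2_set_eq_0_iff)
  then have "T F m = 0" for m
    by (simp add: T)
  then show ?thesis
    using True by (simp add: L2_set_def)
next
  case False
  have "L2_set (\<lambda>m. cmod (T F m)) A / L2_set (\<lambda>m. cmod (F m)) A \<le> l2_opnorm A T"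
    unfolding l2_opnorm_def T by (rule cSUP_upper[OF UNIV_I bdd_above_l2_quotients[OF A]])
  moreover have "L2_set (\<lambda>m. cmod (F m)) A > 0"
    using False by (simp add: less_le)
  ultimately show ?thesis
    by (simp add: divide_le_eq)
qed

text \<open>
  If \<open>w n = \<Sum>\<^sub>m M n m v m\<close>, the form is the pairing of \<open>u\<close> with \<open>w\<close>, and \<open>\<parallel>w\<parallel>\<^sup>2\<close> is the pairing of
  \<open>v\<close> with \<open>T\<close> applied to the conjugate of \<open>v\<close>; Cauchy-Schwarz applies to both pairings.
\<close>

lemma bilinear_form_bound:
  fixes M :: "'a \<Rightarrow> 'b \<Rightarrow> complex"
  assumes fin: "finite S" and T: "T = (\<lambda>F m. \<Sum>m'\<in>S. (\<Sum>n\<in>R. M n m * cnj (M n m')) * F m')"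
  shows "cmod (\<Sum>n\<in>R. \<Sum>m\<in>S. M n m * u n * v m)
         \<le> sqrt (l2_opnorm S T) * L2_set (\<lambda>n. cmod (u n)) R * L2_set (\<lambda>m. cmod (v m)) S"
proof -
  define w where "w n = (\<Sum>m\<in>S. M n m * v m)" for n
  let ?U = "L2_set (\<lambda>n. cmod (u n)) R" and ?V = "L2_set (\<lambda>m. cmod (v m)) S"
  have "complex_of_real (\<Sum>n\<in>R. (cmod (w n))\<^sup>2)
      = (\<Sum>n\<in>R. (\<Sum>m\<in>S. M n m * v m) * (\<Sum>m'\<in>S. cnj (M n m') * cnj (v m')))"
    by (simp only: of_real_sum complex_norm_square w_def cnj_sum complex_cnj_mult)
  also have "\<dots> = (\<Sum>n\<in>R. \<Sum>(m, m')\<in>S \<times> S. v m * (M n m * cnj (M n m') * cnj (v m')))"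
    unfolding sum_product sum.cartesian_product split_def by (simp only: mult_ac)
  also have "\<dots> = (\<Sum>(m, m')\<in>S \<times> S. \<Sum>n\<in>R. v m * (M n m * cnj (M n m') * cnj (v m')))"
    unfolding split_def by (rule sum.swap)
  also have "\<dots> = (\<Sum>m\<in>S. v m * T (\<lambda>m. cnj (v m)) m)"
    unfolding T sum.cartesian_product[symmetric] sum_distrib_left sum_distrib_right ..
  finally have "cmod (complex_of_real (\<Sum>n\<in>R. (cmod (w n))\<^sup>2))
      = cmod (\<Sum>m\<in>S. v m * T (\<lambda>m. cnj (v m)) m)"
    by (rule arg_cong)
  then have "(\<Sum>n\<in>R. (cmod (w n))\<^sup>2) = cmod (\<Sum>m\<in>S. v m * T (\<lambda>m. cnj (v m)) m)"
    by (simp only: norm_of_real abs_of_nonneg sum_nonneg zero_le_power2)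
  also have "\<dots> \<le> (\<Sum>m\<in>S. \<bar>cmod (v m)\<bar> * \<bar>cmod (T (\<lambda>m. cnj (v m)) m)\<bar>)"
    by (rule order_trans[OF norm_sum]) (simp add: norm_mult)
  also have "\<dots> \<le> ?V * L2_set (\<lambda>m. cmod (T (\<lambda>m. cnj (v m)) m)) S"
    by (rule L2_set_mult_ineq)
  also have "\<dots> \<le> ?V * (l2_opnorm S T * ?V)"
    using l2_opnorm_bound[OF fin T, of "\<lambda>m. cnj (v m)"] by (intro mult_left_mono) auto
  finally have "L2_set (\<lambda>n. cmod (w n)) R \<le> sqrt (?V * (l2_opnorm S T * ?V))"
    by (simp add: L2_set_def)
  also have "\<dots> = sqrt (l2_opnorm S T) * ?V"
  proof -
    have "?V * (l2_opnorm S T * ?V) = l2_opnorm S T * ?V\<^sup>2"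
      by (simp add: power2_eq_square)
    then show ?thesis
      by (simp add: real_sqrt_mult)
  qed
  finally have w: "L2_set (\<lambda>n. cmod (w n)) R \<le> sqrt (l2_opnorm S T) * ?V" .
  have "cmod (\<Sum>n\<in>R. \<Sum>m\<in>S. M n m * u n * v m) = cmod (\<Sum>n\<in>R. u n * w n)"
    unfolding w_def sum_distrib_left by (simp only: mult_ac)
  also have "\<dots> \<le> (\<Sum>n\<in>R. \<bar>cmod (u n)\<bar> * \<bar>cmod (w n)\<bar>)"
    by (rule order_trans[OF norm_sum]) (simp add: norm_mult)
  also have "\<dots> \<le> ?U * L2_set (\<lambda>n. cmod (w n)) R"
    by (rule L2_set_mult_ineq)
  also have "\<dots> \<le> ?U * (sqrt (l2_opnorm S T) * ?V)"
    using w by (intro mult_left_mono) auto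
  finally show ?thesis
    by (simp add: mult_ac)
qed

lemma entry_le_l2_opnorm:
  fixes M :: "'a \<Rightarrow> 'b \<Rightarrow> complex"
  assumes fin: "finite S" "finite R"
    and T: "T = (\<lambda>F m. \<Sum>m'\<in>S. (\<Sum>n\<in>R. M n m * cnj (M n m')) * F m')"
    and "n0 \<in> R" "m0 \<in> S"
  shows "cmod (M n0 m0) \<le> sqrt (l2_opnorm S T)"
proof -
  let ?u = "\<lambda>n. if n = n0 then 1 else 0 :: complex"
    and ?v = "\<lambda>m. if m = m0 then 1 else 0 :: complex"
  have "(\<Sum>n\<in>R. \<Sum>m\<in>S. M n m * ?u n * ?v m)
      = (\<Sum>n\<in>R. \<Sum>m\<in>S. if m = m0 then if n = n0 then M n m else 0 else 0)"
    by (intro sum.cong refl) auto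
  also have "\<dots> = M n0 m0"
    using assms by simp
  finally have "(\<Sum>n\<in>R. \<Sum>m\<in>S. M n m * ?u n * ?v m) = M n0 m0" .
  moreover have "L2_set (\<lambda>n. cmod (?u n)) R = 1" "L2_set (\<lambda>m. cmod (?v m)) S = 1"
    using assms
    by (simp_all add: L2_set_def if_distrib[of cmod] if_distrib[of "\<lambda>x. x\<^sup>2"] cong: if_cong)
  ultimately show ?thesis
    using bilinear_form_bound[OF fin(1) T, of ?u ?v] by simp
qed

section \<open>Characters and Fourier coefficients modulo \<open>p\<close>\<close>

lemma psi_add: "psi p (s + t) = psi p s * psi p t"
  by (simp add: psi_def ring_distribs add_divide_distrib exp_add)

lemma psi_0 [simp]: "psi p 0 = 1"
  by (simp add: psi_def)

lemma psi_minus: "psi p (- t) = cnj (psi p t)"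
  by (simp add: psi_def exp_cnj)

lemma cmod_psi [simp]: "cmod (psi p t) = 1"
  by (simp add: psi_def norm_exp_eq_Re)

definition fourier_coeff :: "nat \<Rightarrow> (int \<Rightarrow> complex) \<Rightarrow> int \<Rightarrow> complex" where
  "fourier_coeff p f n = avg (FF p) (\<lambda>x. f x * psi p (- (n * x)))"

text \<open>
  The truncated kernel, extended \<open>p\<close>-periodically to all integers. Frequency shifts such as
  \<open>(n - H\<^sub>1, m + H\<^sub>2)\<close> can then be written with integer operations, without reduction.
\<close>

definition kerKt_per :: "nat \<Rightarrow> (nat \<Rightarrow> int) \<Rightarrow> (nat \<Rightarrow> int) \<Rightarrow>
    int \<Rightarrow> int \<Rightarrow> complex" where
  "kerKt_per p \<phi>1 \<phi>2 n m = (if int p dvd m then 0 else kerK p \<phi>1 \<phi>2 n m)"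

context
  fixes p :: nat
  assumes p_pos: "p > 0"
begin

lemma FF_eq: "FF p = {0..<int p}"
  by (auto simp: residue_ring_def)

lemma finite_FF [simp]: "finite (FF p)"
  by (simp add: FF_eq)

lemma card_FF [simp]: "card (FF p) = p"
  by (simp add: FF_eq)

lemma FF_mod: "x \<in> FF p \<Longrightarrow> x mod int p = x"
  by (simp add: FF_eq)

lemma mod_in_FF [simp]: "x mod int p \<in> FF p"
  using p_pos by (simp add: FF_eq)

lemma psi_eq_1_iff: "psi p t = 1 \<longleftrightarrow> int p dvd t"
proof -
  have "psi p t = 1 \<longleftrightarrow> (\<exists>n. 2 * pi * of_int t / of_nat p = of_int (2 * n) * pi)"
    by (simp add: psi_def exp_eq_1)
  also have "\<dots> \<longleftrightarrow> (\<exists>n. real_of_int t = of_int (int p * n))"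
    using p_pos by (simp add: field_simps)
  also have "\<dots> \<longleftrightarrow> int p dvd t"
    unfolding of_int_eq_iff dvd_def ..
  finally show ?thesis .
qed

lemma psi_mod [simp]: "psi p (t mod int p) = psi p t"
proof -
  have "psi p t = psi p (int p * (t div int p)) * psi p (t mod int p)"
    by (simp flip: psi_add)
  moreover have "psi p (int p * (t div int p)) = 1"
    by (simp add: psi_eq_1_iff)
  ultimately show ?thesis
    by simp
qed

lemma psi_cong: "s mod int p = t mod int p \<Longrightarrow> psi p s = psi p t"
  by (metis psi_mod)

lemma sum_FF_shift:
  assumes "\<And>x. f (x mod int p) = f x"
  shows "(\<Sum>x\<in>FF p. f (x + c)) = (\<Sum>x\<in>FF p. f x)"
  by (rule sum.reindex_bij_witness[of _ "\<lambda>x. (x - c) mod int p" "\<lambda>x. (x + c) mod int p"])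
     (auto simp: assms mod_simps FF_mod)

lemma sum_FF_reflect:
  assumes "\<And>x. f (x mod int p) = f x"
  shows "(\<Sum>x\<in>FF p. f (c - x)) = (\<Sum>x\<in>FF p. f x)"
  by (rule sum.reindex_bij_witness[of _ "\<lambda>x. (c - x) mod int p" "\<lambda>x. (c - x) mod int p"])
     (auto simp: assms mod_simps FF_mod)

lemma sum_psi: "(\<Sum>x\<in>FF p. psi p (n * x)) = (if int p dvd n then of_nat p else 0)"
proof (cases "int p dvd n")
  case True
  then have "psi p (n * x) = 1" for x
    by (simp add: psi_eq_1_iff)
  then show ?thesis
    using True by simp
next
  case False
  \<comment> \<open>Translating \<open>x\<close> by \<open>1\<close> multiplies the sum by \<open>\<psi>(n) \<noteq> 1\<close>, so it vanishes.\<close>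
  have "(\<Sum>x\<in>FF p. psi p (n * x)) = (\<Sum>x\<in>FF p. psi p (n * (x + 1)))"
    by (rule sum_FF_shift[symmetric]) (rule psi_cong, simp add: mod_simps)
  also have "\<dots> = psi p n * (\<Sum>x\<in>FF p. psi p (n * x))"
    by (simp add: ring_distribs psi_add sum_distrib_left mult.commute)
  finally show ?thesis
    using False psi_eq_1_iff[of n] by simp
qed

lemma dvd_diff_FF: "x \<in> FF p \<Longrightarrow> y \<in> FF p \<Longrightarrow> int p dvd x - y \<longleftrightarrow> x = y"
  by (metis FF_mod mod_eq_dvd_iff)

lemma fourier_coeff_mod [simp]: "fourier_coeff p f (n mod int p) = fourier_coeff p f n"
proof -
  have "psi p (- (n mod int p * x)) = psi p (- (n * x))" for x
    unfolding psi_minus by (rule arg_cong[OF psi_cong]) (simp add: mod_simps)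
  then show ?thesis
    by (simp add: fourier_coeff_def)
qed

lemma fourier_inversion:
  assumes "x \<in> FF p"
  shows "f x = (\<Sum>n\<in>FF p. fourier_coeff p f n * psi p (n * x))"
proof -
  have psi: "psi p (- (n * y)) * psi p (n * x) = psi p ((x - y) * n)" for n y
    by (simp add: algebra_simps flip: psi_add)
  have "(\<Sum>n\<in>FF p. fourier_coeff p f n * psi p (n * x))
        = (\<Sum>n\<in>FF p. \<Sum>y\<in>FF p. f y * psi p ((x - y) * n) / of_nat p)"
    unfolding fourier_coeff_def avg_def card_FF psi[symmetric]
    by (simp add: sum_divide_distrib sum_distrib_right mult.assoc)
  also have "\<dots> = (\<Sum>y\<in>FF p. \<Sum>n\<in>FF p. f y * psi p ((x - y) * n) / of_nat p)"
    by (rule sum.swap)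
  also have "\<dots> = (\<Sum>y\<in>FF p. f y * (\<Sum>n\<in>FF p. psi p ((x - y) * n)) / of_nat p)"
    by (simp only: sum_distrib_left sum_divide_distrib)
  also have "\<dots> = (\<Sum>y\<in>FF p. if y = x then f x else 0)"
    using assms p_pos by (intro sum.cong refl) (auto simp: sum_psi dvd_diff_FF)
  also have "\<dots> = f x"
    using assms finite_FF by simp
  finally show ?thesis ..
qed

lemma parseval:
  "(\<Sum>n\<in>FF p. (cmod (fourier_coeff p f n))\<^sup>2) = avg (FF p) (\<lambda>x. (cmod (f x))\<^sup>2)"
proof -
  let ?c = "fourier_coeff p f"
  have "?c n * cnj (?c n) = (\<Sum>x\<in>FF p. f x * cnj (?c n * psi p (n * x)) / of_nat p)" for n
  proof -
    have *: "?c n * z = (\<Sum>x\<in>FF p. f x * (z * cnj (psi p (n * x))) / of_nat p)" for z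
      unfolding fourier_coeff_def avg_def card_FF psi_minus
      by (simp add: sum_divide_distrib sum_distrib_left sum_distrib_right mult_ac)
    show ?thesis
      unfolding complex_cnj_mult by (rule *)
  qed
  then have "(\<Sum>n\<in>FF p. ?c n * cnj (?c n))
        = (\<Sum>n\<in>FF p. \<Sum>x\<in>FF p. f x * cnj (?c n * psi p (n * x)) / of_nat p)"
    by (simp only:)
  also have "\<dots> = (\<Sum>x\<in>FF p. \<Sum>n\<in>FF p. f x * cnj (?c n * psi p (n * x)) / of_nat p)"
    by (rule sum.swap)
  also have "\<dots> = (\<Sum>x\<in>FF p. f x * cnj (\<Sum>n\<in>FF p. ?c n * psi p (n * x)) / of_nat p)"
    by (simp only: cnj_sum sum_distrib_left sum_divide_distrib)
  also have "\<dots> = (\<Sum>x\<in>FF p. f x * cnj (f x) / of_nat p)"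
    by (intro sum.cong refl) (simp only: fourier_inversion[symmetric])
  also have "\<dots> = complex_of_real (avg (FF p) (\<lambda>x. (cmod (f x))\<^sup>2))"
    unfolding avg_def card_FF
    by (simp only: complex_norm_square[symmetric] of_real_sum of_real_divide of_real_of_nat_eq
          sum_divide_distrib)
  finally have "complex_of_real (\<Sum>n\<in>FF p. (cmod (?c n))\<^sup>2)
      = complex_of_real (avg (FF p) (\<lambda>x. (cmod (f x))\<^sup>2))"
    by (simp only: complex_norm_square of_real_sum)
  then show ?thesis
    by (simp only: of_real_eq_iff)
qed

section \<open>Correlations of Fourier coefficients\<close>

text \<open>
  The sum over the second pair of frequencies is reindexed by its difference \<open>(h1, h2)\<close> from the
  first one. In the product of the two terms the character is then \<open>\<psi>(h1 x1) \<psi>(-h2 x2)\<close>, whatever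
  \<open>n\<close> and \<open>m\<close> are, and since \<open>a\<close> depends on \<open>x2\<close> only and \<open>b\<close> on \<open>x1\<close> only, the average factors
  into two Fourier coefficients. The opposite signs in \<open>n - h1\<close> and \<open>m + h2\<close> are those in the
  definition of \<open>\<Delta>\<^sub>H\<close>.
\<close>

lemma avg_norm_sq_expansion:
  fixes k a b :: "int \<Rightarrow> int \<Rightarrow> complex"
  assumes k1: "\<And>n m. k (n mod int p) m = k n m" and k2: "\<And>n m. k n (m mod int p) = k n m"
    and a: "\<And>n x. a (n mod int p) x = a n x" and b: "\<And>m x. b (m mod int p) x = b m x"
  shows "complex_of_real (avg (FF p \<times> FF p) (\<lambda>(x1, x2).
             (cmod (\<Sum>n\<in>FF p. \<Sum>m\<in>FF p. k n m * a n x2 * b m x1 * psi p (n * x1 + m * x2)))\<^sup>2))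
         = (\<Sum>(h1, h2)\<in>FF p \<times> FF p. \<Sum>n\<in>FF p. \<Sum>m\<in>FF p.
             k n m * cnj (k (n - h1) (m + h2))
             * fourier_coeff p (\<lambda>x. a n x * cnj (a (n - h1) x)) h2
             * fourier_coeff p (\<lambda>x. b m x * cnj (b (m + h2) x)) (- h1))"
proof -
  define t where "t n m x1 x2 = k n m * a n x2 * b m x1 * psi p (n * x1 + m * x2)" for n m x1 x2
  have t1: "t (n mod int p) m x1 x2 = t n m x1 x2" for n m x1 x2
    unfolding t_def k1 a by (rule arg_cong[where f = "(*) _"], rule psi_cong)
      (metis mod_add_left_eq mod_mult_left_eq)
  have t2: "t n (m mod int p) x1 x2 = t n m x1 x2" for n m x1 x2
    unfolding t_def k2 b by (rule arg_cong[where f = "(*) _"], rule psi_cong)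
      (metis mod_add_right_eq mod_mult_left_eq)
  \<comment> \<open>Periodicity in the frequencies makes the substitution \<open>n' = n - h1\<close>, \<open>m' = m + h2\<close> legitimate.\<close>
  have shift: "(\<Sum>n'\<in>FF p. \<Sum>m'\<in>FF p. cnj (t n' m' x1 x2))
      = (\<Sum>h1\<in>FF p. \<Sum>h2\<in>FF p. cnj (t (n - h1) (m + h2) x1 x2))" for n m x1 x2
  proof -
    have "(\<Sum>m'\<in>FF p. cnj (t n' m' x1 x2)) = (\<Sum>h2\<in>FF p. cnj (t n' (m + h2) x1 x2))" for n'
      using sum_FF_shift[of "\<lambda>m'. cnj (t n' m' x1 x2)" m] by (simp add: t2 add.commute)
    moreover have "(\<Sum>n'\<in>FF p. \<Sum>h2\<in>FF p. cnj (t n' (m + h2) x1 x2))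
        = (\<Sum>h1\<in>FF p. \<Sum>h2\<in>FF p. cnj (t (n - h1) (m + h2) x1 x2))"
      using sum_FF_reflect[of "\<lambda>n'. \<Sum>h2\<in>FF p. cnj (t n' (m + h2) x1 x2)" n]
      by (simp add: t1)
    ultimately show ?thesis by simp
  qed
  have sq: "complex_of_real ((cmod (\<Sum>n\<in>FF p. \<Sum>m\<in>FF p. t n m x1 x2))\<^sup>2)
     = (\<Sum>n\<in>FF p. \<Sum>m\<in>FF p. \<Sum>h1\<in>FF p. \<Sum>h2\<in>FF p. t n m x1 x2 * cnj (t (n - h1) (m + h2) x1 x2))"
    for x1 x2
  proof -
    have "complex_of_real ((cmod (\<Sum>n\<in>FF p. \<Sum>m\<in>FF p. t n m x1 x2))\<^sup>2)
       = (\<Sum>n\<in>FF p. \<Sum>m\<in>FF p. t n m x1 x2) * (\<Sum>n\<in>FF p. \<Sum>m\<in>FF p. cnj (t n m x1 x2))"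
      by (simp only: complex_norm_square cnj_sum)
    also have "\<dots> = (\<Sum>n\<in>FF p. \<Sum>m\<in>FF p. t n m x1 x2 *
                       (\<Sum>n'\<in>FF p. \<Sum>m'\<in>FF p. cnj (t n' m' x1 x2)))"
      by (simp only: sum_distrib_right)
    also have "\<dots> = (\<Sum>n\<in>FF p. \<Sum>m\<in>FF p. t n m x1 x2 *
                       (\<Sum>h1\<in>FF p. \<Sum>h2\<in>FF p. cnj (t (n - h1) (m + h2) x1 x2)))"
      by (intro sum.cong refl arg_cong[where f = "(*) _"] shift)
    finally show ?thesis
      by (simp only: sum_distrib_left)
  qed
  let ?A = "\<lambda>h1 h2 n. fourier_coeff p (\<lambda>x. a n x * cnj (a (n - h1) x)) h2"
  let ?B = "\<lambda>h1 h2 m. fourier_coeff p (\<lambda>x. b m x * cnj (b (m + h2) x)) (- h1)"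
  have sep: "(\<Sum>x1\<in>FF p. \<Sum>x2\<in>FF p. t n m x1 x2 * cnj (t (n - h1) (m + h2) x1 x2))
      = of_nat (p * p) * (k n m * cnj (k (n - h1) (m + h2)) * ?A h1 h2 n * ?B h1 h2 m)"
    for n m h1 h2
  proof -
    have e: "psi p (n * x1 + m * x2) * cnj (psi p ((n - h1) * x1 + (m + h2) * x2))
        = psi p (- (h2 * x2)) * psi p (h1 * x1)" for x1 x2
      by (simp add: algebra_simps flip: psi_minus psi_add)
    have tt: "t n m x1 x2 * cnj (t (n - h1) (m + h2) x1 x2)
        = k n m * cnj (k (n - h1) (m + h2))
          * ((b m x1 * cnj (b (m + h2) x1) * psi p (h1 * x1))
             * (a n x2 * cnj (a (n - h1) x2) * psi p (- (h2 * x2))))" for x1 x2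
    proof -
      have "t n m x1 x2 * cnj (t (n - h1) (m + h2) x1 x2)
        = k n m * cnj (k (n - h1) (m + h2))
          * ((b m x1 * cnj (b (m + h2) x1)) * (a n x2 * cnj (a (n - h1) x2)))
          * (psi p (n * x1 + m * x2) * cnj (psi p ((n - h1) * x1 + (m + h2) * x2)))"
        by (simp only: t_def complex_cnj_mult mult_ac)
      then show ?thesis
        unfolding e by (simp only: mult_ac)
    qed
    have "(\<Sum>x1\<in>FF p. \<Sum>x2\<in>FF p. t n m x1 x2 * cnj (t (n - h1) (m + h2) x1 x2))
      = k n m * cnj (k (n - h1) (m + h2))
          * ((\<Sum>x1\<in>FF p. b m x1 * cnj (b (m + h2) x1) * psi p (h1 * x1))
             * (\<Sum>x2\<in>FF p. a n x2 * cnj (a (n - h1) x2) * psi p (- (h2 * x2))))"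
      unfolding tt sum_product by (simp only: sum_distrib_left)
    then show ?thesis
      using p_pos by (simp add: fourier_coeff_def avg_def)
  qed
  have "(\<Sum>x1\<in>FF p. \<Sum>x2\<in>FF p. complex_of_real ((cmod (\<Sum>n\<in>FF p. \<Sum>m\<in>FF p. t n m x1 x2))\<^sup>2))
      = (\<Sum>h1\<in>FF p. \<Sum>h2\<in>FF p. \<Sum>n\<in>FF p. \<Sum>m\<in>FF p. \<Sum>x1\<in>FF p. \<Sum>x2\<in>FF p.
           t n m x1 x2 * cnj (t (n - h1) (m + h2) x1 x2))"
    (is "?L = ?R")
  proof -
    let ?f = "\<lambda>x1 x2 n m h1 h2. t n m x1 x2 * cnj (t (n - h1) (m + h2) x1 x2)"
    have "?L = (\<Sum>x1\<in>FF p. \<Sum>x2\<in>FF p. \<Sum>n\<in>FF p. \<Sum>m\<in>FF p. \<Sum>h1\<in>FF p. \<Sum>h2\<in>FF p. ?f x1 x2 n m h1 h2)"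
      by (simp only: sq)
    also have "\<dots> = (\<Sum>n\<in>FF p. \<Sum>m\<in>FF p. \<Sum>x1\<in>FF p. \<Sum>x2\<in>FF p. \<Sum>h1\<in>FF p. \<Sum>h2\<in>FF p. ?f x1 x2 n m h1 h2)"
      by (rule sum_swap_pairs)
    also have "\<dots> = (\<Sum>n\<in>FF p. \<Sum>m\<in>FF p. \<Sum>h1\<in>FF p. \<Sum>h2\<in>FF p. \<Sum>x1\<in>FF p. \<Sum>x2\<in>FF p. ?f x1 x2 n m h1 h2)"
      by (rule sum.cong[OF refl], rule sum.cong[OF refl], rule sum_swap_pairs)
    also have "\<dots> = ?R"
      by (rule sum_swap_pairs)
    finally show ?thesis .
  qed
  also have "\<dots> = of_nat (p * p) * (\<Sum>h1\<in>FF p. \<Sum>h2\<in>FF p. \<Sum>n\<in>FF p. \<Sum>m\<in>FF p.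
      k n m * cnj (k (n - h1) (m + h2)) * ?A h1 h2 n * ?B h1 h2 m)"
    by (simp only: sep sum_distrib_left)
  finally have eq: "complex_of_real (\<Sum>x1\<in>FF p. \<Sum>x2\<in>FF p.
        (cmod (\<Sum>n\<in>FF p. \<Sum>m\<in>FF p. t n m x1 x2))\<^sup>2)
      = of_nat (p * p) * (\<Sum>h1\<in>FF p. \<Sum>h2\<in>FF p. \<Sum>n\<in>FF p. \<Sum>m\<in>FF p.
      k n m * cnj (k (n - h1) (m + h2)) * ?A h1 h2 n * ?B h1 h2 m)"
    by (simp only: of_real_sum)
  show ?thesis
    unfolding avg_def sum.cartesian_product[symmetric] t_def[symmetric] of_real_divide eq
    using p_pos by (simp add: card_cartesian_product)
qed

text \<open>
  For fixed \<open>n\<close> and \<open>h1\<close>, Parseval in \<open>h2\<close> turns the sum into the average of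
  \<open>|a\<^sub>n|\<^sup>2 |a\<^bsub>n-h1\<^esub>|\<^sup>2\<close>, and the sum over \<open>n\<close> and \<open>h1\<close> of these products is a full square.
\<close>

lemma sum_correlation_energy:
  assumes a: "\<And>n x. a (n mod int p) x = a n x"
  shows "(\<Sum>(h1, h2)\<in>FF p \<times> FF p. \<Sum>n\<in>FF p.
            (cmod (fourier_coeff p (\<lambda>x. a n x * cnj (a (n - h1) x)) h2))\<^sup>2)
         = avg (FF p) (\<lambda>x. (\<Sum>n\<in>FF p. (cmod (a n x))\<^sup>2)\<^sup>2)"
proof -
  let ?c = "\<lambda>h1 n. fourier_coeff p (\<lambda>x. a n x * cnj (a (n - h1) x))"
  have "(\<Sum>(h1, h2)\<in>FF p \<times> FF p. \<Sum>n\<in>FF p. (cmod (?c h1 n h2))\<^sup>2)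
      = (\<Sum>h1\<in>FF p. \<Sum>h2\<in>FF p. \<Sum>n\<in>FF p. (cmod (?c h1 n h2))\<^sup>2)"
    by (rule sum.cartesian_product[symmetric])
  also have "\<dots> = (\<Sum>h1\<in>FF p. \<Sum>n\<in>FF p. \<Sum>h2\<in>FF p. (cmod (?c h1 n h2))\<^sup>2)"
    by (intro sum.cong refl sum.swap)
  also have "\<dots> = (\<Sum>n\<in>FF p. \<Sum>h1\<in>FF p. \<Sum>h2\<in>FF p. (cmod (?c h1 n h2))\<^sup>2)"
    by (rule sum.swap)
  also have "\<dots> = (\<Sum>n\<in>FF p. \<Sum>h1\<in>FF p.
      avg (FF p) (\<lambda>x. (cmod (a n x))\<^sup>2 * (cmod (a (n - h1) x))\<^sup>2))"
    by (simp add: parseval norm_mult power_mult_distrib)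
  also have "\<dots> = (\<Sum>n\<in>FF p. \<Sum>n'\<in>FF p.
      avg (FF p) (\<lambda>x. (cmod (a n x))\<^sup>2 * (cmod (a n' x))\<^sup>2))"
    by (rule sum.cong[OF refl], rule sum_FF_reflect) (simp add: a)
  also have "\<dots> = avg (FF p) (\<lambda>x. (\<Sum>n\<in>FF p. (cmod (a n x))\<^sup>2)\<^sup>2)"
    by (simp only: sum_avg power2_eq_square[of "sum _ _"] sum_product)
  finally show ?thesis .
qed

text \<open>
  The variant for the second factor, where the two coordinates of the shift exchange their parts
  and change sign; reflecting both sums reduces it to the first version.
\<close>

lemma sum_correlation_energy_shift:
  assumes b: "\<And>m x. b (m mod int p) x = b m x"
  shows "(\<Sum>(h1, h2)\<in>FF p \<times> FF p. \<Sum>m\<in>FF p.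
            (cmod (fourier_coeff p (\<lambda>x. b m x * cnj (b (m + h2) x)) (- h1)))\<^sup>2)
         = avg (FF p) (\<lambda>x. (\<Sum>m\<in>FF p. (cmod (b m x))\<^sup>2)\<^sup>2)"
proof -
  define P where "P u v = (\<Sum>m\<in>FF p.
      (cmod (fourier_coeff p (\<lambda>x. b m x * cnj (b (m - u) x)) v))\<^sup>2)" for u v
  have P1: "P (u mod int p) v = P u v" for u v
  proof -
    have "b (m - u mod int p) x = b (m - u) x" for m x
      by (metis b mod_diff_right_eq)
    then show ?thesis
      by (simp add: P_def)
  qed
  have P2: "P u (v mod int p) = P u v" for u v
    by (simp add: P_def fourier_coeff_mod)
  have "(\<Sum>h1\<in>FF p. \<Sum>h2\<in>FF p. P (0 - h2) (0 - h1)) = (\<Sum>h1\<in>FF p. \<Sum>u\<in>FF p. P u (0 - h1))"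
    by (rule sum.cong[OF refl], rule sum_FF_reflect) (rule P1)
  also have "\<dots> = (\<Sum>v\<in>FF p. \<Sum>u\<in>FF p. P u v)"
    by (rule sum_FF_reflect) (simp add: P2)
  also have "\<dots> = (\<Sum>u\<in>FF p. \<Sum>v\<in>FF p. P u v)"
    by (rule sum.swap)
  also have "\<dots> = avg (FF p) (\<lambda>x. (\<Sum>m\<in>FF p. (cmod (b m x))\<^sup>2)\<^sup>2)"
    using sum_correlation_energy[of b, OF b]
    unfolding P_def sum.cartesian_product[symmetric] .
  finally show ?thesis
    unfolding sum.cartesian_product[symmetric] by (simp add: P_def)
qed

section \<open>The bilinear estimate\<close>

lemma fourier_coeff_0_of_real:
  "fourier_coeff p (\<lambda>x. complex_of_real (r x)) 0 = complex_of_real (avg (FF p) r)"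
  by (simp add: fourier_coeff_def avg_def)

text \<open>
  In the expansion by shifts, \<open>h = 0\<close> has nonnegative correlations and is bounded through the
  supremum \<open>\<kappa>\<close> of \<open>|k|\<^sup>2\<close>. All other \<open>h\<close> are bounded by the operator norm and summed by
  Cauchy-Schwarz; the sums of squared correlations are computed over all \<open>h\<close>, so the two energies
  come out without loss.
\<close>

lemma avg_norm_sq_bound:
  fixes k a b :: "int \<Rightarrow> int \<Rightarrow> complex"
  assumes k1: "\<And>n m. k (n mod int p) m = k n m" and k2: "\<And>n m. k n (m mod int p) = k n m"
    and a: "\<And>n x. a (n mod int p) x = a n x" and b: "\<And>m x. b (m mod int p) x = b m x"
    and sup: "\<And>n m. n \<in> FF p \<Longrightarrow> m \<in> FF p \<Longrightarrow> (cmod (k n m))\<^sup>2 \<le> \<kappa>"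
    and N: "\<And>h1 h2. (h1, h2) \<in> FF p \<times> FF p - {(0, 0)} \<Longrightarrow>
          l2_opnorm (FF p) (\<lambda>F m. \<Sum>m'\<in>FF p. (\<Sum>n\<in>FF p.
            k n m * cnj (k (n - h1) (m + h2)) * cnj (k n m' * cnj (k (n - h1) (m' + h2)))) * F m')
          \<le> N" and N0: "N \<ge> 0"
  shows "avg (FF p \<times> FF p) (\<lambda>(x1, x2).
           (cmod (\<Sum>n\<in>FF p. \<Sum>m\<in>FF p. k n m * a n x2 * b m x1 * psi p (n * x1 + m * x2)))\<^sup>2)
         \<le> \<kappa> * avg (FF p) (\<lambda>x. \<Sum>n\<in>FF p. (cmod (a n x))\<^sup>2)
              * avg (FF p) (\<lambda>x. \<Sum>m\<in>FF p. (cmod (b m x))\<^sup>2)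
           + sqrt N * sqrt (avg (FF p) (\<lambda>x. (\<Sum>n\<in>FF p. (cmod (a n x))\<^sup>2)\<^sup>2))
              * sqrt (avg (FF p) (\<lambda>x. (\<Sum>m\<in>FF p. (cmod (b m x))\<^sup>2)\<^sup>2))"
    (is "?lhs \<le> ?diag + sqrt N * ?R * ?C")
proof -
  define A where "A h n = fourier_coeff p (\<lambda>x. a n x * cnj (a (n - fst h) x)) (snd h)" for h n
  define B where "B h m = fourier_coeff p (\<lambda>x. b m x * cnj (b (m + snd h) x)) (- fst h)" for h m
  define S where "S h = (\<Sum>n\<in>FF p. \<Sum>m\<in>FF p.
      k n m * cnj (k (n - fst h) (m + snd h)) * A h n * B h m)" for h
  let ?LA = "\<lambda>h. L2_set (\<lambda>n. cmod (A h n)) (FF p)"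
    and ?LB = "\<lambda>h. L2_set (\<lambda>m. cmod (B h m)) (FF p)"
  let ?H = "FF p \<times> FF p"
  have fin: "finite ?H"
    by (simp add: finite_FF)
  have zero: "(0, 0) \<in> ?H"
    using p_pos by (simp add: FF_eq)
  have "complex_of_real ?lhs = (\<Sum>h\<in>?H. S h)"
    by (subst avg_norm_sq_expansion[where k = k and a = a and b = b])
       (simp_all add: k1 k2 a b S_def A_def B_def split_def)
  from arg_cong[OF this, of cmod] have "\<bar>?lhs\<bar> = cmod (\<Sum>h\<in>?H. S h)"
    by (simp only: norm_of_real)
  then have "?lhs \<le> cmod (\<Sum>h\<in>?H. S h)"
    by linarith
  also have "\<dots> \<le> (\<Sum>h\<in>?H. cmod (S h))"
    by (rule norm_sum)
  also have "\<dots> = cmod (S (0, 0)) + (\<Sum>h\<in>?H - {(0, 0)}. cmod (S h))"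
    by (rule sum.remove[OF fin zero])
  also have "\<dots> \<le> ?diag + sqrt N * ?R * ?C"
  proof (rule add_mono)
    let ?a = "\<lambda>n. avg (FF p) (\<lambda>x. (cmod (a n x))\<^sup>2)"
      and ?b = "\<lambda>m. avg (FF p) (\<lambda>x. (cmod (b m x))\<^sup>2)"
    have "S (0, 0) = complex_of_real (\<Sum>n\<in>FF p. \<Sum>m\<in>FF p. (cmod (k n m))\<^sup>2 * ?a n * ?b m)"
      by (simp only: S_def A_def B_def fst_conv snd_conv diff_zero add_0_right minus_zero
            fourier_coeff_0_of_real complex_norm_square[symmetric] of_real_sum of_real_mult)
    also have "cmod \<dots> = (\<Sum>n\<in>FF p. \<Sum>m\<in>FF p. (cmod (k n m))\<^sup>2 * ?a n * ?b m)"
      unfolding norm_of_real by (intro abs_of_nonneg sum_nonneg mult_nonneg_nonneg avg_nonneg) auto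
    also have "\<dots> \<le> (\<Sum>n\<in>FF p. \<Sum>m\<in>FF p. \<kappa> * ?a n * ?b m)"
      by (intro sum_mono mult_right_mono sup avg_nonneg) auto
    also have "\<dots> = \<kappa> * (\<Sum>n\<in>FF p. ?a n) * (\<Sum>m\<in>FF p. ?b m)"
      by (simp add: sum_distrib_left sum_distrib_right sum_product mult_ac)
    also have "\<dots> = ?diag"
      by (simp only: sum_avg)
    finally show "cmod (S (0, 0)) \<le> ?diag" .
  next
    have "cmod (S h) \<le> sqrt N * (?LA h * ?LB h)" if "h \<in> ?H - {(0, 0)}" for h
    proof -
      let ?T = "\<lambda>F m. \<Sum>m'\<in>FF p. (\<Sum>n\<in>FF p. k n m * cnj (k (n - fst h) (m + snd h))
                  * cnj (k n m' * cnj (k (n - fst h) (m' + snd h)))) * F m'"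
      have "cmod (S h) \<le> sqrt (l2_opnorm (FF p) ?T) * ?LA h * ?LB h"
        unfolding S_def by (rule bilinear_form_bound[OF finite_FF refl])
      also have "\<dots> \<le> sqrt N * ?LA h * ?LB h"
        using N[of "fst h" "snd h"] that by (intro mult_right_mono real_sqrt_le_mono) auto
      finally show ?thesis
        by (simp add: mult.assoc)
    qed
    then have "(\<Sum>h\<in>?H - {(0, 0)}. cmod (S h)) \<le> (\<Sum>h\<in>?H - {(0, 0)}. sqrt N * (?LA h * ?LB h))"
      by (rule sum_mono)
    also have "\<dots> \<le> (\<Sum>h\<in>?H. sqrt N * (?LA h * ?LB h))"
      using N0 fin by (intro sum_mono2) auto
    also have "\<dots> = sqrt N * (\<Sum>h\<in>?H. \<bar>?LA h\<bar> * \<bar>?LB h\<bar>)"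
      by (simp add: sum_distrib_left)
    also have "\<dots> \<le> sqrt N * (L2_set ?LA ?H * L2_set ?LB ?H)"
      using N0 by (intro mult_left_mono L2_set_mult_ineq) auto
    also have "L2_set ?LA ?H = ?R"
      using sum_correlation_energy[of a, OF a] by (simp add: L2_set_def sum_nonneg A_def split_def)
    also have "L2_set ?LB ?H = ?C"
      using sum_correlation_energy_shift[of b, OF b]
      by (simp add: L2_set_def sum_nonneg B_def split_def)
    finally show "(\<Sum>h\<in>?H - {(0, 0)}. cmod (S h)) \<le> sqrt N * ?R * ?C"
      by (simp add: mult.assoc)
  qed
  finally show ?thesis .
qed

section \<open>The kernel\<close>

lemma kerK_eq:
  "kerK p \<phi>1 \<phi>2 n m = avg (FF p) (\<lambda>y. psi p (n * peval p \<phi>1 y + m * peval p \<phi>2 y))"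
proof -
  have "psi p (n \<otimes>\<^bsub>Fp p\<^esub> s \<oplus>\<^bsub>Fp p\<^esub> m \<otimes>\<^bsub>Fp p\<^esub> t) = psi p (n * s + m * t)" for s t
    by (rule psi_cong) (simp add: residue_ring_def mod_simps)
  then show ?thesis
    by (simp add: kerK_def)
qed

lemma kerK_cong:
  assumes "n mod int p = n' mod int p" "m mod int p = m' mod int p"
  shows "kerK p \<phi>1 \<phi>2 n m = kerK p \<phi>1 \<phi>2 n' m'"
proof -
  have "psi p (n * s + m * t) = psi p (n' * s + m' * t)" for s t
    by (rule psi_cong) (metis assms mod_add_cong mod_mult_cong)
  then show ?thesis
    by (simp add: kerK_eq)
qed

lemma kerK_uminus: "kerK p \<phi>1 \<phi>2 (- n) (- m) = cnj (kerK p \<phi>1 \<phi>2 n m)"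
proof -
  have "psi p (- n * s + - m * t) = cnj (psi p (n * s + m * t))" for s t
    by (simp flip: psi_minus)
  then show ?thesis
    by (simp add: kerK_eq avg_def)
qed

lemma cmod_kerK_le_1: "cmod (kerK p \<phi>1 \<phi>2 n m) \<le> 1"
proof -
  have "cmod (\<Sum>y\<in>FF p. psi p (n * peval p \<phi>1 y + m * peval p \<phi>2 y))
      \<le> (\<Sum>y\<in>FF p. cmod (psi p (n * peval p \<phi>1 y + m * peval p \<phi>2 y)))"
    by (rule norm_sum)
  then show ?thesis
    using p_pos by (simp add: kerK_eq avg_def norm_divide card_FF)
qed

lemma kerKt_eq_kerKt_per: "kerKt p \<phi>1 \<phi>2 (n mod int p) (m mod int p) = kerKt_per p \<phi>1 \<phi>2 n m"
  by (auto simp: kerKt_def kerKt_per_def residue_ring_def dvd_eq_mod_eq_0 intro!: kerK_cong)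

lemma kerKt_per_mod1: "kerKt_per p \<phi>1 \<phi>2 (n mod int p) m = kerKt_per p \<phi>1 \<phi>2 n m"
  and kerKt_per_mod2: "kerKt_per p \<phi>1 \<phi>2 n (m mod int p) = kerKt_per p \<phi>1 \<phi>2 n m"
  by (simp_all flip: kerKt_eq_kerKt_per)

lemma DeltaK_eq:
  assumes "p > 1" "n \<in> FF p" "m \<in> FF p"
  shows "DeltaK p \<phi>1 \<phi>2 (h1, h2) n m
         = kerKt_per p \<phi>1 \<phi>2 n m * cnj (kerKt_per p \<phi>1 \<phi>2 (n - h1) (m + h2))"
proof -
  interpret residues "int p" "Fp p"
    using assms by unfold_locales auto
  have "n \<ominus>\<^bsub>Fp p\<^esub> h1 = (n - h1) mod int p"
    unfolding a_minus_def res_neg_eq by (simp add: residue_ring_def mod_simps)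
  moreover have "m \<oplus>\<^bsub>Fp p\<^esub> h2 = (m + h2) mod int p"
    by (simp add: residue_ring_def)
  moreover have "kerKt p \<phi>1 \<phi>2 n m = kerKt_per p \<phi>1 \<phi>2 n m"
    using kerKt_eq_kerKt_per[of \<phi>1 \<phi>2 n m] assms by (simp add: FF_mod)
  ultimately show ?thesis
    by (simp add: DeltaK_def kerKt_eq_kerKt_per)
qed

lemma l2_opnorm_TH:
  assumes "p > 1"
  shows "l2_opnorm (FF p) (TH p \<phi>1 \<phi>2 (h1, h2)) = l2_opnorm (FF p) (\<lambda>F m. \<Sum>m'\<in>FF p. (\<Sum>n\<in>FF p.
      kerKt_per p \<phi>1 \<phi>2 n m * cnj (kerKt_per p \<phi>1 \<phi>2 (n - h1) (m + h2))
        * cnj (kerKt_per p \<phi>1 \<phi>2 n m' * cnj (kerKt_per p \<phi>1 \<phi>2 (n - h1) (m' + h2)))) * F m')"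
proof -
  have "CH p \<phi>1 \<phi>2 (h1, h2) m m' = (\<Sum>n\<in>FF p.
      kerKt_per p \<phi>1 \<phi>2 n m * cnj (kerKt_per p \<phi>1 \<phi>2 (n - h1) (m + h2))
        * cnj (kerKt_per p \<phi>1 \<phi>2 n m' * cnj (kerKt_per p \<phi>1 \<phi>2 (n - h1) (m' + h2))))"
    if "m \<in> FF p" "m' \<in> FF p" for m m'
    unfolding CH_def by (intro sum.cong refl) (simp only: DeltaK_eq[OF assms] that)
  then show ?thesis
    unfolding l2_opnorm_def TH_def
    by (intro SUP_cong refl arg_cong2[where f = "(/)"] L2_set_cong arg_cong[where f = cmod]
          sum.cong) (simp only:)
qed

text \<open>
  The points \<open>(n,m)\<close> and \<open>(-n,-m)\<close> carry conjugate values of the kernel. For odd \<open>p\<close> and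
  \<open>m \<noteq> 0\<close> they differ by a nonzero shift \<open>H\<close>, and the matrix \<open>\<Delta>\<^sub>HK\<close> has the entry \<open>K(n,m)\<^sup>2\<close>,
  which cannot exceed the norm of the matrix.
\<close>

lemma kernel_sup_bound:
  assumes "prime p" "p \<noteq> 2"
    and TH: "\<And>h1 h2. (h1, h2) \<in> FF p \<times> FF p - {(0, 0)} \<Longrightarrow>
          l2_opnorm (FF p) (TH p \<phi>1 \<phi>2 (h1, h2)) \<le> N"
    and nm: "n \<in> FF p" "m \<in> FF p" and "N \<ge> 0"
  shows "(cmod (kerKt_per p \<phi>1 \<phi>2 n m))\<^sup>2 \<le> sqrt N"
proof (cases "int p dvd m")
  case True
  then show ?thesis
    using \<open>N \<ge> 0\<close> by (simp add: kerKt_per_def)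
next
  case False
  have p1: "p > 1"
    using \<open>prime p\<close> by (rule prime_gt_1_nat)
  let ?k = "kerKt_per p \<phi>1 \<phi>2"
  \<comment> \<open>The shift that takes \<open>(n, m)\<close> to \<open>(-n, -m)\<close>.\<close>
  define h1 h2 where "h1 = (2 * n) mod int p" and "h2 = (- 2 * m) mod int p"
  have "\<not> int p dvd - 2 * m"
  proof
    assume "int p dvd - 2 * m"
    then have "int p dvd 2 * m"
      by simp
    then have "int p dvd 2"
      using \<open>prime p\<close> False by (simp add: prime_dvd_mult_iff)
    then have "p dvd 2"
      by presburger
    then show False
      using \<open>p \<noteq> 2\<close> p1 by (auto dest: dvd_imp_le)
  qed
  then have h: "(h1, h2) \<in> FF p \<times> FF p - {(0, 0)}"
    by (simp add: h1_def h2_def mod_in_FF dvd_eq_mod_eq_0)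
  have "(n - h1) mod int p = (- n) mod int p" and "(m + h2) mod int p = (- m) mod int p"
    by (simp_all add: h1_def h2_def mod_simps)
  then have "?k (n - h1) (m + h2) = ?k (- n) (- m)"
    by (metis kerKt_per_mod1 kerKt_per_mod2)
  also have "\<dots> = cnj (?k n m)"
    by (simp add: kerKt_per_def kerK_uminus)
  finally have "(cmod (?k n m))\<^sup>2 = cmod (?k n m * cnj (?k (n - h1) (m + h2)))"
    by (simp add: norm_mult power2_eq_square)
  also have "\<dots> \<le> sqrt (l2_opnorm (FF p) (TH p \<phi>1 \<phi>2 (h1, h2)))"
    unfolding l2_opnorm_TH[OF p1]
    by (rule entry_le_l2_opnorm[OF finite_FF finite_FF refl nm])
  also have "\<dots> \<le> sqrt N"
    using TH[OF h] by simp
  finally show ?thesis .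
qed

section \<open>The operator in Fourier coefficients\<close>

lemma J3_expansion:
  assumes g2: "avg (FF p) (\<lambda>x2. g2 (x1, x2)) = 0"
  shows "J3 p \<phi>1 \<phi>2 g1 g2 (x1, x2) = (\<Sum>n\<in>FF p. \<Sum>m\<in>FF p. kerKt_per p \<phi>1 \<phi>2 n m
           * fourier_coeff p (\<lambda>x1. g1 (x1, x2)) n * fourier_coeff p (\<lambda>x2. g2 (x1, x2)) m
           * psi p (n * x1 + m * x2))"
proof -
  let ?a = "fourier_coeff p (\<lambda>x1. g1 (x1, x2))" and ?b = "fourier_coeff p (\<lambda>x2. g2 (x1, x2))"
  let ?P = "\<lambda>n m y. psi p (n * peval p \<phi>1 y + m * peval p \<phi>2 y)"
  have add: "x \<oplus>\<^bsub>Fp p\<^esub> s = (x + s) mod int p" for x s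
    by (simp add: residue_ring_def)
  have psi: "psi p (n * ((x + s) mod int p)) = psi p (n * x) * psi p (n * s)" for n x s
    unfolding psi_add[symmetric] distrib_left[symmetric]
    by (rule psi_cong) (simp add: mod_simps)
  have "g1 (x1 \<oplus>\<^bsub>Fp p\<^esub> peval p \<phi>1 y, x2) * g2 (x1, x2 \<oplus>\<^bsub>Fp p\<^esub> peval p \<phi>2 y)
      = (\<Sum>n\<in>FF p. \<Sum>m\<in>FF p. ?a n * ?b m * psi p (n * x1 + m * x2) * ?P n m y)" for y
  proof -
    have "g1 (x1 \<oplus>\<^bsub>Fp p\<^esub> peval p \<phi>1 y, x2) * g2 (x1, x2 \<oplus>\<^bsub>Fp p\<^esub> peval p \<phi>2 y)
      = (\<Sum>n\<in>FF p. ?a n * (psi p (n * x1) * psi p (n * peval p \<phi>1 y)))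
        * (\<Sum>m\<in>FF p. ?b m * (psi p (m * x2) * psi p (m * peval p \<phi>2 y)))"
      unfolding add psi[symmetric]
      using fourier_inversion[OF mod_in_FF, of "\<lambda>x1. g1 (x1, x2)"]
            fourier_inversion[OF mod_in_FF, of "\<lambda>x2. g2 (x1, x2)"]
      by (simp only:)
    then show ?thesis
      by (simp only: sum_product psi_add mult_ac)
  qed
  then have "J3 p \<phi>1 \<phi>2 g1 g2 (x1, x2)
      = avg (FF p) (\<lambda>y. \<Sum>n\<in>FF p. \<Sum>m\<in>FF p. ?a n * ?b m * psi p (n * x1 + m * x2) * ?P n m y)"
    by (simp only: J3_def prod.case)
  also have "\<dots> = (\<Sum>n\<in>FF p. \<Sum>m\<in>FF p. ?a n * ?b m * psi p (n * x1 + m * x2) * kerK p \<phi>1 \<phi>2 n m)"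
    unfolding sum_avg[symmetric] kerK_eq
    by (intro sum.cong refl) (simp add: avg_def sum_distrib_left)
  also have "\<dots> = (\<Sum>n\<in>FF p. \<Sum>m\<in>FF p. kerKt_per p \<phi>1 \<phi>2 n m * ?a n * ?b m * psi p (n * x1 + m * x2))"
  proof (intro sum.cong refl)
    fix n m
    \<comment> \<open>The zero mean of \<open>g2\<close> is what allows the truncated kernel.\<close>
    have "?b 0 = 0"
      using g2 by (simp add: fourier_coeff_def)
    then have "?b m = 0" if "int p dvd m"
      using that fourier_coeff_mod[of _ m] by (metis dvd_eq_mod_eq_0)
    then show "?a n * ?b m * psi p (n * x1 + m * x2) * kerK p \<phi>1 \<phi>2 n m
        = kerKt_per p \<phi>1 \<phi>2 n m * ?a n * ?b m * psi p (n * x1 + m * x2)"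
      by (simp add: kerKt_per_def)
  qed
  finally show ?thesis .
qed

lemma norm2_sq_eq_avg_rows:
    "norm2_sq p g = avg (FF p) (\<lambda>x2. avg (FF p) (\<lambda>x1. (cmod (g (x1, x2)))\<^sup>2))"
  and norm2_sq_eq_avg_cols:
    "norm2_sq p g = avg (FF p) (\<lambda>x1. avg (FF p) (\<lambda>x2. (cmod (g (x1, x2)))\<^sup>2))"
proof -
  have c: "norm2_sq p g = (\<Sum>x1\<in>FF p. \<Sum>x2\<in>FF p. (cmod (g (x1, x2)))\<^sup>2) / (p * p)"
    by (simp add: norm2_sq_def avg_def card_cartesian_product card_FF sum.cartesian_product
          split_def)
  then show "norm2_sq p g = avg (FF p) (\<lambda>x1. avg (FF p) (\<lambda>x2. (cmod (g (x1, x2)))\<^sup>2))"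
    by (simp add: avg_def card_FF flip: sum_divide_distrib)
  show "norm2_sq p g = avg (FF p) (\<lambda>x2. avg (FF p) (\<lambda>x1. (cmod (g (x1, x2)))\<^sup>2))"
    unfolding c by (subst sum.swap) (simp add: avg_def card_FF flip: sum_divide_distrib)
qed

lemma norm2_sq_J3_bound:
  assumes p1: "p > 1" and g2: "\<And>x1. x1 \<in> FF p \<Longrightarrow> avg (FF p) (\<lambda>x2. g2 (x1, x2)) = 0"
    and N: "\<And>h1 h2. (h1, h2) \<in> FF p \<times> FF p - {(0, 0)} \<Longrightarrow>
          l2_opnorm (FF p) (TH p \<phi>1 \<phi>2 (h1, h2)) \<le> N" and N0: "N \<ge> 0"
    and sup: "\<And>n m. n \<in> FF p \<Longrightarrow> m \<in> FF p \<Longrightarrow> (cmod (kerKt_per p \<phi>1 \<phi>2 n m))\<^sup>2 \<le> \<kappa>"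
  shows "norm2_sq p (J3 p \<phi>1 \<phi>2 g1 g2) \<le> \<kappa> * norm2_sq p g1 * norm2_sq p g2
           + sqrt N * sqrt (row_energy p g1) * sqrt (col_energy p g2)"
proof -
  define a where "a n x2 = fourier_coeff p (\<lambda>x1. g1 (x1, x2)) n" for n x2
  define b where "b m x1 = fourier_coeff p (\<lambda>x2. g2 (x1, x2)) m" for m x1
  have "norm2_sq p (J3 p \<phi>1 \<phi>2 g1 g2) = avg (FF p \<times> FF p) (\<lambda>(x1, x2).
      (cmod (\<Sum>n\<in>FF p. \<Sum>m\<in>FF p.
        kerKt_per p \<phi>1 \<phi>2 n m * a n x2 * b m x1 * psi p (n * x1 + m * x2)))\<^sup>2)"
    unfolding norm2_sq_def avg_def
    by (rule arg_cong[where f = "\<lambda>s. s / _"], rule sum.cong)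
       (auto simp: J3_expansion g2 a_def b_def)
  also have "\<dots> \<le> \<kappa> * avg (FF p) (\<lambda>x. \<Sum>n\<in>FF p. (cmod (a n x))\<^sup>2)
              * avg (FF p) (\<lambda>x. \<Sum>m\<in>FF p. (cmod (b m x))\<^sup>2)
           + sqrt N * sqrt (avg (FF p) (\<lambda>x. (\<Sum>n\<in>FF p. (cmod (a n x))\<^sup>2)\<^sup>2))
              * sqrt (avg (FF p) (\<lambda>x. (\<Sum>m\<in>FF p. (cmod (b m x))\<^sup>2)\<^sup>2))"
  proof (rule avg_norm_sq_bound)
    show "l2_opnorm (FF p) (\<lambda>F m. \<Sum>m'\<in>FF p. (\<Sum>n\<in>FF p.
        kerKt_per p \<phi>1 \<phi>2 n m * cnj (kerKt_per p \<phi>1 \<phi>2 (n - h1) (m + h2))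
        * cnj (kerKt_per p \<phi>1 \<phi>2 n m' * cnj (kerKt_per p \<phi>1 \<phi>2 (n - h1) (m' + h2)))) * F m') \<le> N"
      if "(h1, h2) \<in> FF p \<times> FF p - {(0, 0)}" for h1 h2
      using N[OF that] unfolding l2_opnorm_TH[OF p1] .
  qed (auto simp: a_def b_def fourier_coeff_mod kerKt_per_mod1 kerKt_per_mod2 sup N0)
  also have "\<dots> = \<kappa> * norm2_sq p g1 * norm2_sq p g2
           + sqrt N * sqrt (row_energy p g1) * sqrt (col_energy p g2)"
    unfolding a_def b_def parseval row_energy_def col_energy_def
    by (simp only: norm2_sq_eq_avg_rows[of g1] norm2_sq_eq_avg_cols[of g2])
  finally show ?thesis .
qed

lemma norm2_sq_le_row_energy: "norm2_sq p g \<le> sqrt (row_energy p g)"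
  unfolding norm2_sq_eq_avg_rows row_energy_def by (rule avg_le_sqrt_avg_sq)

lemma norm2_sq_le_col_energy: "norm2_sq p g \<le> sqrt (col_energy p g)"
  unfolding norm2_sq_eq_avg_cols col_energy_def by (rule avg_le_sqrt_avg_sq)

end

lemma norm2_sq_nonneg: "norm2_sq p g \<ge> 0"
  unfolding norm2_sq_def by (rule avg_nonneg) simp

lemma row_energy_nonneg: "row_energy p g \<ge> 0"
  unfolding row_energy_def by (rule avg_nonneg) simp

lemma col_energy_nonneg: "col_energy p g \<ge> 0"
  unfolding col_energy_def by (rule avg_nonneg) simp

theorem lemma3p1:
  fixes d :: nat and B :: real
  assumes "d > 0" and "B > 0"
  shows "\<exists>C::real. \<forall>(p::nat) (\<phi>1::nat \<Rightarrow> int) (\<phi>2::nat \<Rightarrow> int)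
           (g1::int \<times> int \<Rightarrow> complex) (g2::int \<times> int \<Rightarrow> complex).
     prime p \<longrightarrow>
     \<phi>1 \<in> carrier (UP (Fp p)) \<longrightarrow> \<phi>2 \<in> carrier (UP (Fp p)) \<longrightarrow>
     deg (Fp p) \<phi>1 \<le> d \<longrightarrow> deg (Fp p) \<phi>2 \<le> d \<longrightarrow>
     peval p \<phi>1 \<zero>\<^bsub>Fp p\<^esub> = \<zero>\<^bsub>Fp p\<^esub> \<longrightarrow> peval p \<phi>2 \<zero>\<^bsub>Fp p\<^esub> = \<zero>\<^bsub>Fp p\<^esub> \<longrightarrow>
     lin_indep_pair p \<phi>1 \<phi>2 \<longrightarrow>
     (\<forall>H \<in> FF p \<times> FF p - {(\<zero>\<^bsub>Fp p\<^esub>, \<zero>\<^bsub>Fp p\<^esub>)}.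
        l2_opnorm (FF p) (TH p \<phi>1 \<phi>2 H) \<le> B * real p powr (-1/2)) \<longrightarrow>
     (\<forall>x2 \<in> FF p. avg (FF p) (\<lambda>x1. g1 (x1, x2)) = 0) \<longrightarrow>
     (\<forall>x1 \<in> FF p. avg (FF p) (\<lambda>x2. g2 (x1, x2)) = 0) \<longrightarrow>
     norm2_sq p (J3 p \<phi>1 \<phi>2 g1 g2) \<le>
       C * (1 / real p * norm2_sq p g1 * norm2_sq p g2
            + real p powr (-1/4) * sqrt (row_energy p g1) * sqrt (col_energy p g2))"
proof (intro exI allI impI)
  fix p :: nat and \<phi>1 \<phi>2 :: "nat \<Rightarrow> int" and g1 g2 :: "int \<times> int \<Rightarrow> complex"
  assume "prime p"
    and TH: "\<forall>H \<in> FF p \<times> FF p - {(\<zero>\<^bsub>Fp p\<^esub>, \<zero>\<^bsub>Fp p\<^esub>)}.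
        l2_opnorm (FF p) (TH p \<phi>1 \<phi>2 H) \<le> B * real p powr (-1/2)"
    and g2: "\<forall>x1 \<in> FF p. avg (FF p) (\<lambda>x2. g2 (x1, x2)) = 0"
  define N where "N = B * real p powr (-1/2)"
  define E where "E = sqrt (row_energy p g1) * sqrt (col_energy p g2)"
  define G where "G = norm2_sq p g1 * norm2_sq p g2"
  have p1: "p > 1"
    using \<open>prime p\<close> by (rule prime_gt_1_nat)
  then have p0: "p > 0"
    by simp
  have N0: "N \<ge> 0"
    using \<open>B > 0\<close> by (simp add: N_def)
  have sqrtN: "sqrt N = sqrt B * real p powr (-1/4)"
    by (simp add: N_def real_sqrt_mult flip: powr_half_sqrt) (simp add: powr_powr)
  have G0: "G \<ge> 0"
    by (simp add: G_def norm2_sq_nonneg)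
  have E0: "E \<ge> 0"
    by (simp add: E_def row_energy_nonneg col_energy_nonneg)
  have TH': "l2_opnorm (FF p) (TH p \<phi>1 \<phi>2 (h1, h2)) \<le> N"
    if "(h1, h2) \<in> FF p \<times> FF p - {(0, 0)}" for h1 h2
    using that bspec[OF TH, of "(h1, h2)"] unfolding N_def by (simp add: residue_ring_def)
  have J3: "norm2_sq p (J3 p \<phi>1 \<phi>2 g1 g2) \<le> \<kappa> * G + sqrt N * E"
    if "\<And>n m. n \<in> FF p \<Longrightarrow> m \<in> FF p \<Longrightarrow> (cmod (kerKt_per p \<phi>1 \<phi>2 n m))\<^sup>2 \<le> \<kappa>" for \<kappa>
    using norm2_sq_J3_bound[OF p0 p1 bspec[OF g2] TH' N0 that, of g1]
    by (simp add: G_def E_def mult.assoc)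
  have "norm2_sq p (J3 p \<phi>1 \<phi>2 g1 g2)
      \<le> (2 * sqrt B + 2) * (1 / real p * G + real p powr (-1/4) * E)"
  proof (cases "p = 2")
    case True
    \<comment> \<open>Here \<open>1 = 2 * (1 / p)\<close>: the trivial bound for the kernel is of the order of the first term.\<close>
    have "(cmod (kerKt_per p \<phi>1 \<phi>2 n m))\<^sup>2 \<le> 1" for n m
      using cmod_kerK_le_1[OF p0, of \<phi>1 \<phi>2 n m] by (simp add: kerKt_per_def power_le_one)
    from J3[OF this] have "norm2_sq p (J3 p \<phi>1 \<phi>2 g1 g2) \<le> G + sqrt B * (real p powr (-1/4) * E)"
      by (simp add: sqrtN mult_ac)
    also have "\<dots> \<le> (2 * sqrt B + 2) * (1 / real p * G)
        + (2 * sqrt B + 2) * (real p powr (-1/4) * E)"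
      using True G0 E0 \<open>B > 0\<close> by (intro add_mono mult_right_mono) (auto simp: field_simps)
    finally show ?thesis
      by (simp only: distrib_left)
  next
    case False
    have "norm2_sq p (J3 p \<phi>1 \<phi>2 g1 g2) \<le> sqrt N * G + sqrt N * E"
      by (rule J3) (rule kernel_sup_bound[OF p0 \<open>prime p\<close> False TH' _ _ N0])
    moreover have "G \<le> E"
      unfolding G_def E_def
      by (intro mult_mono norm2_sq_le_row_energy[OF p0] norm2_sq_le_col_energy[OF p0]
            norm2_sq_nonneg real_sqrt_ge_zero row_energy_nonneg)
    then have "sqrt N * G + sqrt N * E \<le> 2 * sqrt B * (real p powr (-1/4) * E)"
      using mult_left_mono[OF _ real_sqrt_ge_zero[OF N0], of G E] by (simp add: sqrtN mult_ac)
    moreover have "2 * sqrt B * (real p powr (-1/4) * E)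
        \<le> (2 * sqrt B + 2) * (1 / real p * G + real p powr (-1/4) * E)"
      using G0 E0 \<open>B > 0\<close> by (intro mult_mono) auto
    ultimately show ?thesis
      by linarith
  qed
  then show "norm2_sq p (J3 p \<phi>1 \<phi>2 g1 g2) \<le>
       (2 * sqrt B + 2) * (1 / real p * norm2_sq p g1 * norm2_sq p g2
            + real p powr (-1/4) * sqrt (row_energy p g1) * sqrt (col_energy p g2))"
    by (simp add: G_def E_def mult.assoc)
qed

end
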